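(* Let $A$ and $B$ be bounded positive operators on the complex Hilbert space $H$ and let $y\in H$. The following assertions are equivalent: (i) $y\in\operatorname{ran}\,(A-(A:B))^{1/2}$; (ii) $y=\lim_{n\to\infty}Ax_n$ for some sequence $(x_n)_{n\in\mathbb{N}}$ in $H$ such that $(A^{1/2}x_n)_{n\in\mathbb{N}}$ and $(B^{1/2}x_n)_{n\in\mathbb{N}}$ are convergent; (iii) there is a nonnegative constant $m_y$, depending only on $y$, such that $$|(x\mid y)|^2\le m_y\cdot\sup\{|(Ax\mid z)|^2 : z\in H,\ (Az\mid z)+(Bz\mid z)\le1\}$$ holds for all $x\in H$.
   Context: A bounded operator $A$ on $H$ is positive if $(Ax\mid x)\ge0$ for all $x\in H$. The parallel sum $A:B$ is the unique bounded positive operator on $H$ with quadratic form $$((A:B)x\mid x)=\inf\{(A(x-y)\mid x-y)+(By\mid y):y\in H\},\qquad x\in H;$$ it satisfies $A:B\le A$, so that $A-(A:B)$ is positive and has a positive square root. *)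

theory Defs
  imports "HOL-Analysis.Analysis"
begin

text \<open>
  A complex inner product space is a real inner product space (with the library's norm, metric
  and topology) carrying a compatible complex scalar multiplication and a sesquilinear form whose
  real part is the given real inner product.  Every complex inner product space arises in this
  way, and uniquely so.  The form is linear in its first argument.
\<close>

class scaleC =
  fixes scaleC :: "complex \<Rightarrow> 'a \<Rightarrow> 'a" (infixr "*\<^sub>C" 75)

class complex_inner = real_inner + scaleC +
  fixes cinner :: "'a \<Rightarrow> 'a \<Rightarrow> complex"
  assumes scaleC_add_right: "a *\<^sub>C (x + y) = a *\<^sub>C x + a *\<^sub>C y"
    and scaleC_add_left: "(a + b) *\<^sub>C x = a *\<^sub>C x + b *\<^sub>C x"
    and scaleC_scaleC: "a *\<^sub>C (b *\<^sub>C x) = (a * b) *\<^sub>C x"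
    and scaleC_of_real: "complex_of_real r *\<^sub>C x = r *\<^sub>R x"
    and cinner_commute: "cinner x y = cnj (cinner y x)"
    and cinner_add_left: "cinner (x + y) z = cinner x z + cinner y z"
    and cinner_scaleC_left: "cinner (a *\<^sub>C x) y = a * cinner x y"
    and Re_cinner: "Re (cinner x y) = inner x y"

class complex_hilbert = complex_inner + complete_space

instantiation complex :: complex_hilbert
begin

definition scaleC_complex :: "complex \<Rightarrow> complex \<Rightarrow> complex"
  where "scaleC_complex a x = a * x"

definition cinner_complex :: "complex \<Rightarrow> complex \<Rightarrow> complex"
  where "cinner_complex x y = x * cnj y"

instance
  by standard
    (simp_all add: scaleC_complex_def cinner_complex_def algebra_simps scaleR_conv_of_real
      inner_complex_def)

end

definition bounded_op :: "('a::complex_hilbert \<Rightarrow> 'a) \<Rightarrow> bool"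
  where "bounded_op A \<longleftrightarrow> bounded_linear A \<and> (\<forall>c x. A (c *\<^sub>C x) = c *\<^sub>C A x)"

definition positive_op :: "('a::complex_hilbert \<Rightarrow> 'a) \<Rightarrow> bool"
  where "positive_op A \<longleftrightarrow>
    bounded_op A \<and> (\<forall>x. Im (cinner (A x) x) = 0 \<and> 0 \<le> Re (cinner (A x) x))"

text \<open>
  The next two definitions are meant for positive arguments only, where the described
  operator exists and is unique.
\<close>

definition sqrt_op :: "('a::complex_hilbert \<Rightarrow> 'a) \<Rightarrow> 'a \<Rightarrow> 'a"
  where "sqrt_op A = (THE S. positive_op S \<and> S \<circ> S = A)"

definition parallel_sum :: "('a::complex_hilbert \<Rightarrow> 'a) \<Rightarrow> ('a \<Rightarrow> 'a) \<Rightarrow> 'a \<Rightarrow> 'a"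
  where "parallel_sum A B = (THE C. positive_op C \<and>
    (\<forall>x. cinner (C x) x =
      complex_of_real (INF y. Re (cinner (A (x - y)) (x - y) + cinner (B y) y))))"

end

theory Submission
  imports Defs
begin

text \<open>
  Put \<open>T z = (A\<^sup>1\<^sup>/\<^sup>2 z, B\<^sup>1\<^sup>/\<^sup>2 z)\<close>, a map into the product space, and let \<open>k x\<close> be the vector in
  the closure of the range of \<open>T\<close> that represents the functional \<open>T z \<mapsto> A x \<bullet> z\<close>.
  Completing the square,
  \<open>A (x - y) \<bullet> (x - y) + B y \<bullet> y = A x \<bullet> x - \<parallel>k x\<parallel>\<^sup>2 + \<parallel>T y - k x\<parallel>\<^sup>2\<close>, so the quadratic form of
  \<open>A - (A:B)\<close> is \<open>\<parallel>k x\<parallel>\<^sup>2\<close>.  The supremum in (iii) is the squared norm of the same functional, hence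
  also \<open>\<parallel>k x\<parallel>\<^sup>2\<close>, and (i) and (iii) both say that \<open>x \<mapsto> x \<bullet> y\<close> is bounded by a multiple of
  \<open>\<parallel>k x\<parallel>\<close>.  By the Riesz representation theorem this means \<open>x \<bullet> y = k x \<bullet> \<kappa>\<close> for some \<open>\<kappa>\<close> in the
  closure of the range of \<open>T\<close>; since \<open>k x \<bullet> T z = x \<bullet> A z\<close>, approximating \<open>\<kappa>\<close> by vectors
  \<open>T (x\<^sub>n)\<close> turns this into \<open>y = lim A x\<^sub>n\<close>, which is (ii).
  All estimates use the real inner product: a rotation \<open>x \<mapsto> c x\<close> with \<open>|c| = 1\<close> makes the complex
  one real.
\<close>

section \<open>Riesz representation and square roots over the reals\<close>

text \<open>First-order condition at a minimum: for small \<open>t\<close> of sign opposite to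
  \<open>d\<close> the linear term would outweigh the quadratic one.\<close>

lemma nonneg_quadratic_imp_zero:
  fixes d N :: real
  assumes "\<And>t. 0 \<le> 2 * t * d + t\<^sup>2 * N" and "0 \<le> N"
  shows "d = 0"
proof (rule ccontr)
  assume "d \<noteq> 0"
  \<comment> \<open>The minimiser \<open>- d / N\<close> with its denominator enlarged by one, so
    that \<open>N = 0\<close> is covered too.\<close>
  have "2 * (- d / (N + 1)) * d + (- d / (N + 1))\<^sup>2 * N = - (d\<^sup>2 * (N + 2)) / (N + 1)\<^sup>2"
    using \<open>0 \<le> N\<close> by (simp add: divide_simps power2_eq_square) (simp add: algebra_simps)
  moreover have "d\<^sup>2 * (N + 2) / (N + 1)\<^sup>2 > 0"
    using \<open>d \<noteq> 0\<close> \<open>0 \<le> N\<close> by (intro divide_pos_pos mult_pos_pos) auto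
  ultimately show False
    using assms(1)[of "- d / (N + 1)"] by simp
qed

text \<open>The infimum of \<open>\<parallel>T x\<parallel>\<^sup>2 - 2 f x\<close> need not be attained; only \<open>T x\<close> converges along a
  minimising sequence.\<close>

lemma riesz_closure_range:
  fixes T :: "'a::real_vector \<Rightarrow> 'b::{real_inner,complete_space}" and f :: "'a \<Rightarrow> real"
  assumes T: "linear T" and f: "linear f" and m: "0 \<le> m"
    and bound: "\<And>x. \<bar>f x\<bar> \<le> m * norm (T x)"
  obtains k where "k \<in> closure (range T)" "\<And>x. f x = T x \<bullet> k" "norm k \<le> m"
proof -
  define \<phi> where "\<phi> x = (norm (T x))\<^sup>2 - 2 * f x" for x
  define c where "c = Inf (range \<phi>)"
  have "- m\<^sup>2 \<le> \<phi> x" for x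
  proof -
    have "0 \<le> (norm (T x) - m)\<^sup>2" by simp
    then show ?thesis
      using bound[of x] by (simp add: \<phi>_def power2_diff algebra_simps)
  qed
  then have bdd: "bdd_below (range \<phi>)" by (intro bdd_belowI2[where m="- m\<^sup>2"])
  then have c_le: "c \<le> \<phi> x" for x by (simp add: c_def cINF_lower)
  have "\<exists>x. \<phi> x < c + 1 / Suc n" for n
    using cInf_lessD[of "range \<phi>" "c + 1 / Suc n"] by (auto simp: c_def)
  then obtain x where x: "\<And>n. \<phi> (x n) < c + 1 / Suc n" by metis
  \<comment> \<open>Parallelogram law for \<open>T u\<close> and \<open>T v\<close>, with
    \<open>\<phi>\<close> at the midpoint bounded below by \<open>c\<close>: near-minimisers have
    close images under \<open>T\<close>.\<close>
  have par: "(norm (T u - T v))\<^sup>2 \<le> 2 * (\<phi> u - c) + 2 * (\<phi> v - c)" for u v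
  proof -
    have "\<phi> ((1/2) *\<^sub>R (u + v)) = (norm ((1/2) *\<^sub>R (T u + T v)))\<^sup>2 - (f u + f v)"
      by (simp add: \<phi>_def linear_scale[OF T] linear_scale[OF f] linear_add[OF T] linear_add[OF f] field_simps del: norm_scaleR)
    also have "\<dots> = ((norm (T u + T v))\<^sup>2) / 4 - (f u + f v)"
      by (simp add: power_divide)
    finally have "(norm (T u + T v))\<^sup>2 \<ge> 4 * c + 4 * (f u + f v)"
      using c_le[of "(1/2) *\<^sub>R (u + v)"] by simp
    moreover have "(norm (T u - T v))\<^sup>2 + (norm (T u + T v))\<^sup>2 = 2 * (norm (T u))\<^sup>2 + 2 * (norm (T v))\<^sup>2"
      by (simp add: power2_norm_eq_inner algebra_simps inner_commute)
    ultimately show ?thesis by (simp add: \<phi>_def)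
  qed
  have "Cauchy (\<lambda>n. T (x n))"
  proof (rule metric_CauchyI)
    fix e :: real assume "e > 0"
    obtain N where N: "1 / Suc N < e\<^sup>2 / 4"
      using nat_approx_posE[of "e\<^sup>2 / 4"] \<open>e > 0\<close> by auto
    have "dist (T (x i)) (T (x j)) < e" if "i \<ge> N" "j \<ge> N" for i j
    proof -
      have *: "\<phi> (x n) - c < e\<^sup>2 / 4" if "n \<ge> N" for n
      proof -
        have "1 / real (Suc n) \<le> 1 / Suc N" using that by (simp add: frac_le)
        then show ?thesis using x[of n] N by linarith
      qed
      have "(norm (T (x i) - T (x j)))\<^sup>2 < e\<^sup>2"
        using par[of "x i" "x j"] *[OF that(1)] *[OF that(2)] by simp
      then show ?thesis using \<open>e > 0\<close> by (simp add: dist_norm power_less_imp_less_base)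
    qed
    then show "\<exists>M. \<forall>i\<ge>M. \<forall>j\<ge>M. dist (T (x i)) (T (x j)) < e" by blast
  qed
  then obtain k where k: "(\<lambda>n. T (x n)) \<longlonglongrightarrow> k"
    using Cauchy_convergent_iff convergent_def by blast
  have lim: "(\<lambda>n. \<phi> (x n)) \<longlonglongrightarrow> c"
  proof (rule tendsto_sandwich[where f="\<lambda>_. c" and h="\<lambda>n. c + 1 / Suc n"])
    show "(\<lambda>n. c + 1 / Suc n) \<longlonglongrightarrow> c"
      using tendsto_add[OF tendsto_const lim_1_over_n[THEN LIMSEQ_Suc], of c] by simp
  qed (use x c_le in \<open>auto intro!: always_eventually less_imp_le\<close>)
  \<comment> \<open>Perturb the minimising sequence by \<open>t *\<^sub>R z\<close> and let
    \<open>n\<close> tend to infinity with \<open>t\<close> fixed: \<open>c\<close> cancels, and the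
    coefficient of the linear term must vanish.\<close>
  have eq: "f z = T z \<bullet> k" for z
  proof -
    have "0 \<le> 2 * t * (T z \<bullet> k - f z) + t\<^sup>2 * (norm (T z))\<^sup>2" for t
    proof -
      have "\<phi> (x n + t *\<^sub>R z) = \<phi> (x n) + 2 * t * (T z \<bullet> T (x n) - f z) + t\<^sup>2 * (norm (T z))\<^sup>2" for n
        unfolding \<phi>_def power2_norm_eq_inner
        by (simp add: linear_scale[OF T] linear_scale[OF f] linear_add[OF T] linear_add[OF f]
            inner_commute algebra_simps) (simp add: power2_eq_square)
      then have "c \<le> \<phi> (x n) + 2 * t * (T z \<bullet> T (x n) - f z) + t\<^sup>2 * (norm (T z))\<^sup>2" for n
        using c_le by metis
      moreover have "(\<lambda>n. \<phi> (x n) + 2 * t * (T z \<bullet> T (x n) - f z) + t\<^sup>2 * (norm (T z))\<^sup>2)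
          \<longlonglongrightarrow> c + 2 * t * (T z \<bullet> k - f z) + t\<^sup>2 * (norm (T z))\<^sup>2"
        by (intro tendsto_intros lim k)
      ultimately have "c \<le> c + 2 * t * (T z \<bullet> k - f z) + t\<^sup>2 * (norm (T z))\<^sup>2"
        by (intro Lim_bounded2) auto
      then show ?thesis by simp
    qed
    from nonneg_quadratic_imp_zero[OF this] show ?thesis by simp
  qed
  \<comment> \<open>Since \<open>T (x n) \<bullet> k = f (x n)\<close>, the bound on
    \<open>f\<close> survives the limit.\<close>
  have "k \<bullet> k \<le> m * norm k"
  proof (rule LIMSEQ_le)
    show "(\<lambda>n. T (x n) \<bullet> k) \<longlonglongrightarrow> k \<bullet> k" by (intro tendsto_intros k)
    show "(\<lambda>n. m * norm (T (x n))) \<longlonglongrightarrow> m * norm k" by (intro tendsto_intros k)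
    show "\<exists>N. \<forall>n\<ge>N. T (x n) \<bullet> k \<le> m * norm (T (x n))"
      using bound eq by (metis abs_le_D1)
  qed
  then have "norm k * norm k \<le> m * norm k" by (simp add: power2_norm_eq_inner[symmetric] power2_eq_square)
  then have "norm k \<le> m" using m by (cases "k = 0") auto
  moreover have "k \<in> closure (range T)"
    using k by (auto simp: closure_sequential intro!: exI[of _ "\<lambda>n. T (x n)"])
  ultimately show thesis using eq that by blast
qed

section \<open>Positive symmetric operators on real inner product spaces\<close>

text \<open>Symmetry is demanded explicitly: over the reals a nonnegative quadratic form does not
  force it.\<close>

definition psd :: "('a::real_inner \<Rightarrow> 'a) \<Rightarrow> bool"
  where "psd A \<longleftrightarrow> bounded_linear A \<and> (\<forall>x y. A x \<bullet> y = x \<bullet> A y) \<and> (\<forall>x. 0 \<le> A x \<bullet> x)"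

lemma psdD:
  assumes "psd A"
  shows psd_bounded_linear: "bounded_linear A" and psd_sym: "A x \<bullet> y = x \<bullet> A y" and psd_nonneg: "0 \<le> A x \<bullet> x"
  using assms unfolding psd_def by blast+

text \<open>Test positivity at \<open>x - (1/c) *\<^sub>R A x\<close>, where \<open>c\<close> bounds
  the norm of \<open>A\<close>. The second-order term is at most
  \<open>(norm (A x))\<^sup>2 / c\<close> and absorbs half of the cross term.\<close>

lemma psd_norm_bound:
  assumes "psd A"
  obtains c where "0 < c" "\<And>x. (norm (A x))\<^sup>2 \<le> c * (A x \<bullet> x)"
proof -
  interpret bounded_linear A using assms by (simp add: psd_def)
  obtain c where c: "c > 0" "\<And>x. norm (A x) \<le> norm x * c" using pos_bounded by blast
  have "(norm (A x))\<^sup>2 \<le> c * (A x \<bullet> x)" for x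
  proof -
    have sym: "A u \<bullet> v = u \<bullet> A v" for u v using assms by (simp add: psd_def)
    have "A (A x) \<bullet> A x \<le> c * (norm (A x))\<^sup>2"
      using norm_cauchy_schwarz[of "A (A x)" "A x"] c(2)[of "A x"]
        mult_right_mono[OF c(2)[of "A x"], of "norm (A x)"]
      by (simp add: power2_eq_square algebra_simps)
    then have "A (A x) \<bullet> A x / c\<^sup>2 \<le> (norm (A x))\<^sup>2 / c"
      using c(1) by (simp add: divide_simps power2_eq_square mult.commute)
    moreover have "0 \<le> A (x - (1/c) *\<^sub>R A x) \<bullet> (x - (1/c) *\<^sub>R A x)"
      using assms unfolding psd_def by blast
    moreover have "A (x - (1/c) *\<^sub>R A x) \<bullet> (x - (1/c) *\<^sub>R A x)
        = A x \<bullet> x - 2 * (norm (A x))\<^sup>2 / c + A (A x) \<bullet> A x / c\<^sup>2"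
      unfolding power2_norm_eq_inner
      by (simp add: diff scaleR inner_diff_left inner_diff_right
          sym[of "A x" x] power2_eq_square divide_simps) (simp add: algebra_simps)
    ultimately have "(norm (A x))\<^sup>2 / c \<le> A x \<bullet> x" by simp
    then show ?thesis using c(1) by (simp add: field_simps)
  qed
  then show thesis using that c(1) by blast
qed

lemma psd_inner_eq_0:
  assumes "psd A" "A x \<bullet> x = 0"
  shows "A x = 0"
  using psd_norm_bound[OF assms(1)] assms(2)
  by (metis mult_zero_right norm_eq_zero power2_less_eq_zero_iff)

text \<open>
  With \<open>X = 1 - A\<close>, the solution satisfies \<open>(1 - Y)\<^sup>2 = A\<close>.  The iteration is dominated in norm by the
  scalar one \<open>t \<mapsto> (1 + t\<^sup>2) / 2\<close>.  Closed properties preserved by the iteration (symmetry,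
  commutation with an operator) pass to \<open>Y\<close>.
\<close>

lemma quadratic_sqrt_iteration:
  fixes X :: "'a::banach \<Rightarrow>\<^sub>L 'a"
  assumes "norm X \<le> 1"
  obtains Y where "norm Y \<le> 1" "2 *\<^sub>R Y = X + (Y o\<^sub>L Y)"
    "\<And>P. closed P \<Longrightarrow> 0 \<in> P \<Longrightarrow> (\<And>Z. Z \<in> P \<Longrightarrow> (1/2) *\<^sub>R (X + (Z o\<^sub>L Z)) \<in> P) \<Longrightarrow> Y \<in> P"
proof -
  define t :: "nat \<Rightarrow> real" where "t = rec_nat 0 (\<lambda>_ s. (1 + s\<^sup>2) / 2)"
  define Y :: "nat \<Rightarrow> ('a \<Rightarrow>\<^sub>L 'a)" where "Y = rec_nat 0 (\<lambda>_ Z. (1/2) *\<^sub>R (X + (Z o\<^sub>L Z)))"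
  have t_simps: "t 0 = 0" "\<And>n. t (Suc n) = (1 + (t n)\<^sup>2) / 2" by (simp_all add: t_def)
  have Y_simps: "Y 0 = 0" "\<And>n. Y (Suc n) = (1/2) *\<^sub>R (X + (Y n o\<^sub>L Y n))" by (simp_all add: Y_def)
  have t01: "0 \<le> t n \<and> t n \<le> 1" for n
    by (induction n) (auto simp: t_simps power_le_one)
  have mono: "t n \<le> t (Suc n)" for n
    using sum_squares_bound[of "t n" 1] by (simp add: t_simps)
  have normY: "norm (Y n) \<le> t n" for n
  proof (induction n)
    case (Suc n)
    have "norm (Y n o\<^sub>L Y n) \<le> (t n)\<^sup>2"
      using norm_blinfun_compose[of "Y n" "Y n"] mult_mono[OF Suc Suc] t01[of n]
      by (simp add: power2_eq_square)
    then show ?case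
      using norm_triangle_ineq[of X "Y n o\<^sub>L Y n"] assms by (simp add: Y_simps t_simps)
  qed (simp add: t_simps Y_simps)
  have diff: "norm (Y (Suc n) - Y n) \<le> t (Suc n) - t n" for n
  proof (induction n)
    case 0
    show ?case using assms by (simp add: t_simps Y_simps)
  next
    case (Suc n)
    let ?E = "Y (Suc n) - Y n"
    \<comment> \<open>The identity \<open>a\<^sup>2 - b\<^sup>2 = a * (a - b) + (a - b) * b\<close>,
      valid without commutation. The increments of \<open>t\<close> obey the same recursion, so the
      domination passes to the next step.\<close>
    have "Y (Suc (Suc n)) - Y (Suc n) = (1/2) *\<^sub>R ((Y (Suc n) o\<^sub>L ?E) + (?E o\<^sub>L Y n))"
    proof -
      have "Y (Suc (Suc n)) - Y (Suc n) = (1/2) *\<^sub>R ((Y (Suc n) o\<^sub>L Y (Suc n)) - (Y n o\<^sub>L Y n))"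
        using Y_simps(2)[of "Suc n"] Y_simps(2)[of n]
        by (metis add_diff_cancel_left scaleR_right_diff_distrib)
      then show ?thesis
        by (simp add: blinfun_eqI blinfun.bilinear_simps)
    qed
    moreover have "norm (Y (Suc n) o\<^sub>L ?E) \<le> t (Suc n) * (t (Suc n) - t n)"
      by (rule order_trans[OF norm_blinfun_compose]) (intro mult_mono Suc normY; simp add: t01)
    moreover have "norm (?E o\<^sub>L Y n) \<le> (t (Suc n) - t n) * t n"
      by (rule order_trans[OF norm_blinfun_compose]) (intro mult_mono Suc normY; simp add: mono)
    moreover have "t (Suc (Suc n)) - t (Suc n) = (t (Suc n) * (t (Suc n) - t n) + (t (Suc n) - t n) * t n) / 2"
    proof -
      have "t (Suc (Suc n)) - t (Suc n) = ((t (Suc n))\<^sup>2 - (t n)\<^sup>2) / 2"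
        using arg_cong2[where f="(-)", OF t_simps(2)[of "Suc n"] t_simps(2)[of n]]
        by (simp add: field_simps)
      then show ?thesis by (simp add: power2_eq_square algebra_simps)
    qed
    ultimately show ?case
      using norm_triangle_ineq[of "Y (Suc n) o\<^sub>L ?E" "?E o\<^sub>L Y n"] by simp
  qed
  \<comment> \<open>A bounded monotone \<open>t\<close> has summable increments, and these dominate
    the norms of the increments of \<open>Y\<close>.\<close>
  have "convergent t"
  proof (rule Bseq_monoseq_convergent)
    show "Bseq t" using t01 by (intro BseqI'[of _ 1]) simp
    show "monoseq t" using mono by (simp add: monoseq_Suc)
  qed
  then have "summable (\<lambda>n. t (Suc n) - t n)"
    using telescope_summable convergent_def by blast
  then have "summable (\<lambda>n. Y (Suc n) - Y n)"
    by (rule summable_comparison_test[rotated]) (use diff in blast)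
  then obtain L where L: "Y \<longlonglongrightarrow> L"
    using summable_LIMSEQ sum_lessThan_telescope[of Y] by (fastforce simp: Y_simps)
  have "(\<lambda>n. (1/2) *\<^sub>R (X + (Y n o\<^sub>L Y n))) \<longlonglongrightarrow> (1/2) *\<^sub>R (X + (L o\<^sub>L L))"
    by (intro tendsto_intros bounded_bilinear.tendsto[OF bounded_bilinear_blinfun_compose] L)
  then have "L = (1/2) *\<^sub>R (X + (L o\<^sub>L L))"
    using LIMSEQ_unique LIMSEQ_Suc[OF L] by (simp add: Y_simps)
  from arg_cong[OF this, of "scaleR 2"] have "2 *\<^sub>R L = X + (L o\<^sub>L L)" by simp
  moreover have "norm L \<le> 1"
    using normY t01 by (intro LIMSEQ_le_const2[OF tendsto_norm[OF L]]) (meson order_trans)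
  moreover have "L \<in> P" if "closed P" "0 \<in> P" "\<And>Z. Z \<in> P \<Longrightarrow> (1/2) *\<^sub>R (X + (Z o\<^sub>L Z)) \<in> P" for P
  proof -
    have "Y n \<in> P" for n by (induction n) (use that in \<open>auto simp: Y_simps\<close>)
    then show ?thesis using closed_sequentially[OF that(1) _ L] by blast
  qed
  ultimately show thesis using that by blast
qed

text \<open>Scale first: \<open>psd_norm_bound\<close> makes \<open>X = 1 - A / c\<close> a
  contraction. If \<open>2 Y = X + Y\<^sup>2\<close>, then \<open>S = sqrt c * (1 - Y)\<close>
  satisfies \<open>S\<^sup>2 = c * (1 - X) = A\<close>, and \<open>norm Y \<le> 1\<close> makes
  \<open>S\<close> positive. The commutation clause serves uniqueness and complex linearity
  later.\<close>

lemma psd_sqrt: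
  fixes A :: "'a::{real_inner,banach} \<Rightarrow> 'a"
  assumes "psd A"
  obtains S where "psd S" "S \<circ> S = A"
    "\<And>C. bounded_linear C \<Longrightarrow> C \<circ> A = A \<circ> C \<Longrightarrow> C \<circ> S = S \<circ> C"
proof -
  interpret A: bounded_linear A using assms by (simp add: psd_def)
  have symA: "A x \<bullet> y = x \<bullet> A y" for x y using assms by (simp add: psd_def)
  obtain c where c: "0 < c" "\<And>x. (norm (A x))\<^sup>2 \<le> c * (A x \<bullet> x)"
    using psd_norm_bound[OF assms] by blast
  define X where "X = Blinfun (\<lambda>x. x - (1/c) *\<^sub>R A x)"
  have X: "blinfun_apply X x = x - (1/c) *\<^sub>R A x" for x
    unfolding X_def
    by (subst bounded_linear_Blinfun_apply)
      (auto intro!: bounded_linear_intros A.bounded_linear_axioms)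
  have "norm X \<le> 1"
  proof (rule norm_blinfun_bound)
    fix x
    have "(norm (X x))\<^sup>2 = (norm x)\<^sup>2 - 2 * (A x \<bullet> x) / c + (norm (A x))\<^sup>2 / c\<^sup>2"
      using c(1) unfolding power2_norm_eq_inner X
      by (simp add: inner_commute inner_diff_left inner_diff_right power2_eq_square divide_simps)
        (simp add: algebra_simps)
    also have "\<dots> \<le> (norm x)\<^sup>2 - 2 * (A x \<bullet> x) / c + (A x \<bullet> x) / c"
      using c(1) divide_right_mono[OF c(2)[of x], of "c\<^sup>2"]
      by (simp add: power2_eq_square)
    also have "\<dots> \<le> (norm x)\<^sup>2"
      using c(1) psd_nonneg[OF assms, of x] by (simp add: divide_simps)
    finally show "norm (X x) \<le> 1 * norm x"
      using power2_le_imp_le[of "norm (X x)" "norm x"] by simp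
  qed simp
  then obtain Y where Y: "norm Y \<le> 1" "2 *\<^sub>R Y = X + (Y o\<^sub>L Y)"
    and ind: "\<And>P. closed P \<Longrightarrow> 0 \<in> P \<Longrightarrow>
      (\<And>Z. Z \<in> P \<Longrightarrow> (1/2) *\<^sub>R (X + (Z o\<^sub>L Z)) \<in> P) \<Longrightarrow> Y \<in> P"
    using quadratic_sqrt_iteration by blast
  \<comment> \<open>Symmetric operators form a closed set containing 0, and the iteration preserves
    it because \<open>X\<close> is symmetric.\<close>
  have "Y \<in> {Z. \<forall>x y. blinfun_apply Z x \<bullet> y = x \<bullet> blinfun_apply Z y}"
    by (rule ind)
      (auto intro!: closed_Collect_all closed_Collect_eq continuous_intros
        simp: blinfun.bilinear_simps X inner_simps symA)
  then have symY: "Y x \<bullet> y = x \<bullet> Y y" for x y by blast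
  define S where "S x = sqrt c *\<^sub>R (x - Y x)" for x
  have "bounded_linear S"
    unfolding S_def by (intro bounded_linear_intros)
  moreover have "S x \<bullet> y = x \<bullet> S y" for x y
    by (simp add: S_def inner_simps symY)
  moreover have "0 \<le> S x \<bullet> x" for x
  proof -
    have "Y x \<bullet> x \<le> norm (Y x) * norm x" by (rule norm_cauchy_schwarz)
    also have "\<dots> \<le> norm x * norm x"
      using norm_blinfun[of Y x] mult_right_mono[OF Y(1), of "norm x"]
      by (intro mult_right_mono) auto
    finally show ?thesis
      using c(1) by (simp add: S_def inner_simps power2_norm_eq_inner[symmetric] power2_eq_square)
  qed
  ultimately have "psd S" by (simp add: psd_def)
  moreover have "S (S x) = A x" for x
  proof -
    have "S (S x) = c *\<^sub>R (x - 2 *\<^sub>R Y x + Y (Y x))"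
      using c(1) by (simp add: S_def blinfun.bilinear_simps algebra_simps scaleR_2)
    also have "2 *\<^sub>R Y x = X x + Y (Y x)"
      using arg_cong[OF Y(2), of "\<lambda>Z. blinfun_apply Z x"] by (simp add: blinfun.bilinear_simps)
    finally show ?thesis using c(1) by (simp add: X)
  qed
  moreover have "C \<circ> S = S \<circ> C" if C: "bounded_linear C" "C \<circ> A = A \<circ> C" for C
  proof -
    interpret C: bounded_linear C by fact
    have CA: "C (A x) = A (C x)" for x using fun_cong[OF C(2), of x] by simp
    have "Y \<in> {Z. \<forall>x. C (blinfun_apply Z x) = blinfun_apply Z (C x)}"
      by (rule ind)
        (auto intro!: closed_Collect_all closed_Collect_eq continuous_intros C.continuous_on
          simp: blinfun.bilinear_simps X C.add C.diff C.scaleR CA C.zero)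
    then show ?thesis by (auto simp: S_def C.diff C.scaleR)
  qed
  ultimately show thesis using that[of S] by (auto simp: comp_def)
qed

text \<open>For \<open>y = S x - R x\<close>, commutation gives
  \<open>S y + R y = S (S x) - R (R x) = 0\<close>. Both quadratic forms are nonnegative, so both
  vanish at \<open>y\<close>; hence \<open>S y = R y = 0\<close>, and symmetry gives
  \<open>y \<bullet> y = 0\<close>.\<close>

lemma psd_sqrt_unique:
  fixes S R :: "'a::real_inner \<Rightarrow> 'a"
  assumes "psd S" "psd R" "S \<circ> S = R \<circ> R" "S \<circ> R = R \<circ> S"
  shows "S = R"
proof
  fix x
  interpret S: bounded_linear S using assms by (simp add: psd_def)
  interpret R: bounded_linear R using assms by (simp add: psd_def)
  have SS: "S (S u) = R (R u)" and SR: "S (R u) = R (S u)" for u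
    using fun_cong[OF assms(3), of u] fun_cong[OF assms(4), of u] by auto
  define y where "y = S x - R x"
  have "S y + R y = 0" by (simp add: y_def S.diff R.diff SS SR)
  then have "S y \<bullet> y + R y \<bullet> y = 0" by (metis inner_add_left inner_zero_left)
  moreover have "0 \<le> S y \<bullet> y" "0 \<le> R y \<bullet> y" using assms psd_nonneg by blast+
  ultimately have "S y \<bullet> y = 0" "R y \<bullet> y = 0" by linarith+
  then have "S y = 0" "R y = 0" using assms(1,2) psd_inner_eq_0 by blast+
  moreover
  have "y \<bullet> y = x \<bullet> (S y - R y)"
  proof -
    have "y \<bullet> y = S x \<bullet> y - R x \<bullet> y" unfolding y_def by (rule inner_diff_left)
    then show ?thesis
      by (simp add: psd_sym[OF assms(1), of x y] psd_sym[OF assms(2), of x y] inner_diff_right)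
  qed
  ultimately show "S x = R x" by (simp add: y_def)
qed

text \<open>Polarisation at \<open>x + z\<close>: by symmetry the two cross terms coincide.\<close>

lemma psd_eq_if_quadratic_form_eq:
  assumes "psd A" "psd B" "\<And>x. A x \<bullet> x = B x \<bullet> x"
  shows "A = B"
proof
  fix x
  interpret A: bounded_linear A using assms by (simp add: psd_def)
  interpret B: bounded_linear B using assms by (simp add: psd_def)
  have symA: "A u \<bullet> v = A v \<bullet> u" for u v using psd_sym[OF assms(1)] by (metis inner_commute)
  have symB: "B u \<bullet> v = B v \<bullet> u" for u v using psd_sym[OF assms(2)] by (metis inner_commute)
  have "A x \<bullet> z = B x \<bullet> z" for z
    using assms(3)[of "x + z"] assms(3)[of x] assms(3)[of z]
    by (simp add: A.add B.add inner_simps symA[of z x] symB[of z x])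
  then show "A x = B x" using vector_eq_rdot by blast
qed

section \<open>Complex inner products\<close>

instance complex_hilbert \<subseteq> banach ..

lemma cinner_scaleC_right:
  fixes x :: "'a::complex_inner"
  shows "cinner x (c *\<^sub>C y) = cnj c * cinner x y"
  by (metis cinner_commute cinner_scaleC_left complex_cnj_mult)

lemma Im_cinner:
  fixes x :: "'a::complex_inner"
  shows "Im (cinner x y) = inner x (\<i> *\<^sub>C y)"
  by (simp add: Re_cinner[symmetric] cinner_scaleC_right)

lemma inner_scaleC_left:
  fixes x :: "'a::complex_inner"
  shows "inner (c *\<^sub>C x) y = inner x (cnj c *\<^sub>C y)"
  by (simp add: Re_cinner[symmetric] cinner_scaleC_left cinner_scaleC_right)

lemma norm_scaleC:
  fixes x :: "'a::complex_inner"
  shows "norm (c *\<^sub>C x) = cmod c * norm x"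
proof -
  have "inner (c *\<^sub>C x) (c *\<^sub>C x) = inner (complex_of_real ((cmod c)\<^sup>2) *\<^sub>C x) x"
    by (simp add: inner_scaleC_left scaleC_scaleC complex_norm_square[of c] mult.commute[of "cnj c"] del: of_real_power)
  also have "\<dots> = (cmod c * norm x)\<^sup>2"
    unfolding scaleC_of_real by (simp add: norm_eq_sqrt_inner power_mult_distrib)
  finally show ?thesis
    by (simp add: norm_eq_sqrt_inner[of "c *\<^sub>C x"])
qed

lemma scaleC_1: "1 *\<^sub>C x = x" and scaleC_minus_1: "(- 1) *\<^sub>C x = - x"
  for x :: "'a::complex_inner"
  using scaleC_of_real[of 1 x] scaleC_of_real[of "- 1" x] by simp_all

lemma inner_square_le_cmod_cinner:
  fixes x :: "'a::complex_inner"
  shows "(x \<bullet> y)\<^sup>2 \<le> (cmod (cinner x y))\<^sup>2"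
  unfolding Re_cinner[symmetric] using abs_Re_le_cmod[of "cinner x y"]
  by (simp add: abs_le_square_iff[symmetric])

lemma cmod_cinner_rotate:
  fixes x :: "'a::complex_inner"
  obtains c where "cmod c = 1" "cmod (cinner x y) = inner (c *\<^sub>C x) y"
proof (cases "cinner x y = 0")
  case True
  then show thesis using that[of 1] by (simp add: Re_cinner[symmetric] cinner_scaleC_left)
next
  case False
  let ?c = "cnj (sgn (cinner x y))"
  have "?c * cinner x y = complex_of_real (cmod (cinner x y))"
    using False complex_norm_square[of "cinner x y"]
    by (simp add: sgn_eq field_simps power2_eq_square)
  then show thesis
    using that[of ?c] False by (simp add: Re_cinner[symmetric] cinner_scaleC_left norm_sgn)
qed

lemma bounded_linear_scaleC: "bounded_linear (\<lambda>x::'a::complex_inner. c *\<^sub>C x)"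
proof (rule bounded_linear_intro[where K = "cmod c"])
  show "c *\<^sub>C (r *\<^sub>R x) = r *\<^sub>R (c *\<^sub>C x)" for r and x :: 'a
    by (simp add: scaleC_of_real[symmetric] scaleC_scaleC mult.commute)
qed (simp_all add: scaleC_add_right norm_scaleC mult.commute)

text \<open>This transfers the real theory to complex operators. A real-valued quadratic form yields
  symmetry by polarisation; conversely, symmetry and commutation with \<open>\<i>\<close> make
  \<open>A x \<bullet> (\<i> *\<^sub>C x)\<close> equal to its own negative.\<close>

lemma positive_op_iff_psd:
  "positive_op A \<longleftrightarrow> psd A \<and> (\<forall>c x. A (c *\<^sub>C x) = c *\<^sub>C A x)"
proof (intro iffI conjI)
  assume A: "positive_op A"
  then interpret bounded_linear A by (simp add: positive_op_def bounded_op_def)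
  have scale: "A (c *\<^sub>C x) = c *\<^sub>C A x" for c x
    using A by (simp add: positive_op_def bounded_op_def)
  then show "\<forall>c x. A (c *\<^sub>C x) = c *\<^sub>C A x" by blast
  have im: "A x \<bullet> (\<i> *\<^sub>C x) = 0" for x
    using A by (simp add: positive_op_def Im_cinner)
  have "A x \<bullet> y = x \<bullet> A y" for x y
  proof -
    have "A x \<bullet> (\<i> *\<^sub>C z) + A z \<bullet> (\<i> *\<^sub>C x) = 0" for z
      using im[of "x + z"] im[of x] im[of z] by (simp add: add scaleC_add_right inner_simps)
    \<comment> \<open>This choice of \<open>z\<close> turns the first summand into
      \<open>A x \<bullet> y\<close> and the second into \<open>- (A y \<bullet> x)\<close>.\<close>
    from this[of "(- \<i>) *\<^sub>C y"] show ?thesis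
      by (simp add: scale scaleC_scaleC inner_scaleC_left scaleC_1 scaleC_minus_1 inner_commute)
  qed
  moreover have "0 \<le> A x \<bullet> x" for x
    using A by (simp add: positive_op_def Re_cinner)
  ultimately show "psd A" by (simp add: psd_def bounded_linear_axioms)
next
  assume A: "psd A \<and> (\<forall>c x. A (c *\<^sub>C x) = c *\<^sub>C A x)"
  have "Im (cinner (A x) x) = 0" for x
  proof -
    have "A x \<bullet> (\<i> *\<^sub>C x) = x \<bullet> (\<i> *\<^sub>C A x)"
      using A psd_sym[of A] by simp
    also have "\<dots> = - (A x \<bullet> (\<i> *\<^sub>C x))"
      using inner_scaleC_left[of "\<i>" x "A x"] inner_scaleC_left[of "- \<i>" "A x" x]
      by (simp add: Re_cinner[symmetric] Im_cinner[symmetric] cinner_scaleC_right) (metis cinner_commute cnj.sel(2))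
    finally show ?thesis by (simp add: Im_cinner)
  qed
  then show "positive_op A"
    using A psdD[of A] by (simp add: positive_op_def bounded_op_def Re_cinner)
qed

section \<open>Square roots and the parallel sum of positive operators\<close>

text \<open>The commutation clause of \<open>psd_sqrt\<close> is used twice: with multiplication by
  \<open>c\<close> for complex homogeneity, and with a competing root \<open>R\<close>, which
  commutes with \<open>A = R \<circ> R\<close>, for the uniqueness behind
  \<open>THE\<close>.\<close>

lemma sqrt_op:
  assumes "positive_op A"
  shows positive_sqrt_op: "positive_op (sqrt_op A)" and sqrt_op_comp_self: "sqrt_op A \<circ> sqrt_op A = A"
proof -
  have A: "psd A" "\<And>c x. A (c *\<^sub>C x) = c *\<^sub>C A x"
    using assms by (auto simp: positive_op_iff_psd)
  obtain S where S: "psd S" "S \<circ> S = A"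
    and comm: "\<And>C. bounded_linear C \<Longrightarrow> C \<circ> A = A \<circ> C \<Longrightarrow> C \<circ> S = S \<circ> C"
    using psd_sqrt[OF A(1)] by blast
  have "S (c *\<^sub>C x) = c *\<^sub>C S x" for c x
    using comm[OF bounded_linear_scaleC[of c]] A(2) by (auto simp: fun_eq_iff)
  then have "positive_op S" using S by (simp add: positive_op_iff_psd)
  moreover have "R = S" if "positive_op R" "R \<circ> R = A" for R
  proof (rule psd_sqrt_unique)
    show R: "psd R" using that by (simp add: positive_op_iff_psd)
    show "R \<circ> S = S \<circ> R"
      using that(2) by (intro comm psd_bounded_linear[OF R]) (auto simp: o_assoc)
  qed (use S that in auto)
  ultimately have "sqrt_op A = S"
    unfolding sqrt_op_def using S(2) by (intro the_equality) blast+
  with \<open>positive_op S\<close> S(2) show "positive_op (sqrt_op A)" "sqrt_op A \<circ> sqrt_op A = A"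
    by simp_all
qed

lemma positive_opD:
  assumes "positive_op A"
  shows positive_op_bounded_linear: "bounded_linear A"
    and positive_op_sym: "A x \<bullet> y = x \<bullet> A y"
    and positive_op_nonneg: "0 \<le> A x \<bullet> x"
    and positive_op_scaleC: "A (c *\<^sub>C x) = c *\<^sub>C A x"
    and positive_op_sqrt_apply: "sqrt_op A (sqrt_op A x) = A x"
proof -
  have "psd A" and scale: "\<forall>c x. A (c *\<^sub>C x) = c *\<^sub>C A x"
    using assms unfolding positive_op_iff_psd by blast+
  then show "bounded_linear A" "A x \<bullet> y = x \<bullet> A y" "0 \<le> A x \<bullet> x" "A (c *\<^sub>C x) = c *\<^sub>C A x"
    using psdD by blast+
  show "sqrt_op A (sqrt_op A x) = A x"
    using fun_cong[OF sqrt_op_comp_self[OF assms], of x] by simp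
qed

lemma positive_op_cinner:
  assumes "positive_op A"
  shows "cinner (A x) x = complex_of_real (A x \<bullet> x)"
  using assms by (simp add: positive_op_def complex_eq_iff Re_cinner)

lemma sqrt_op_inner:
  assumes "positive_op A"
  shows "sqrt_op A x \<bullet> sqrt_op A z = A x \<bullet> z"
  using positive_op_sym[OF positive_sqrt_op[OF assms]] positive_op_sqrt_apply[OF assms] by metis

text \<open>As \<open>D x \<bullet> x\<close> is the squared norm of \<open>sqrt_op D x\<close>, one
  direction is Cauchy-Schwarz; the other is the Riesz lemma with \<open>sqrt_op D\<close> in the
  role of \<open>T\<close>, followed by symmetry. It links (i) with (iii).\<close>

lemma range_sqrt_op_iff:
  assumes "positive_op D"
  shows "y \<in> range (sqrt_op D) \<longleftrightarrow> (\<exists>m\<ge>0. \<forall>x. (cmod (cinner x y))\<^sup>2 \<le> m * (D x \<bullet> x))"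
proof
  let ?R = "sqrt_op D"
  have R: "positive_op ?R" by (rule positive_sqrt_op[OF assms])
  have norm_R: "(norm (?R x))\<^sup>2 = D x \<bullet> x" for x
    by (simp add: power2_norm_eq_inner sqrt_op_inner[OF assms])
  {
    assume "y \<in> range ?R"
    then obtain w where w: "y = ?R w" by blast
    have "(cmod (cinner x y))\<^sup>2 \<le> (norm w)\<^sup>2 * (D x \<bullet> x)" for x
    proof -
      obtain c where c: "cmod c = 1" "cmod (cinner x y) = (c *\<^sub>C x) \<bullet> y"
        by (rule cmod_cinner_rotate)
      have "cmod (cinner x y) = (c *\<^sub>C ?R x) \<bullet> w"
        using c(2) unfolding w by (simp add: positive_op_sym[OF R, symmetric] positive_op_scaleC[OF R])
      also have "\<dots> \<le> norm (?R x) * norm w"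
        using norm_cauchy_schwarz[of "c *\<^sub>C ?R x" w] by (simp add: norm_scaleC c(1))
      finally have "(cmod (cinner x y))\<^sup>2 \<le> (norm (?R x) * norm w)\<^sup>2"
        by (intro power_mono) auto
      then show ?thesis by (simp add: power_mult_distrib norm_R mult.commute)
    qed
    then show "\<exists>m\<ge>0. \<forall>x. (cmod (cinner x y))\<^sup>2 \<le> m * (D x \<bullet> x)"
      by (intro exI[of _ "(norm w)\<^sup>2"]) auto
  next
    assume "\<exists>m\<ge>0. \<forall>x. (cmod (cinner x y))\<^sup>2 \<le> m * (D x \<bullet> x)"
    then obtain m where m: "0 \<le> m" "\<And>x. (cmod (cinner x y))\<^sup>2 \<le> m * (D x \<bullet> x)" by blast
    have "\<bar>x \<bullet> y\<bar> \<le> sqrt m * norm (?R x)" for x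
    proof (rule power2_le_imp_le)
      show "\<bar>x \<bullet> y\<bar>\<^sup>2 \<le> (sqrt m * norm (?R x))\<^sup>2"
        using order_trans[OF inner_square_le_cmod_cinner m(2)] m(1)
        by (simp add: power_mult_distrib norm_R)
    qed (use m in auto)
    moreover have "linear ?R" "linear (\<lambda>x. x \<bullet> y)"
      using positive_op_bounded_linear[OF R] bounded_linear.linear bounded_linear_inner_left by blast+
    ultimately obtain k where "\<And>x. x \<bullet> y = ?R x \<bullet> k"
      using riesz_closure_range[of ?R "\<lambda>x. x \<bullet> y" "sqrt m"] m(1) by (metis real_sqrt_ge_zero)
    then have "x \<bullet> y = x \<bullet> ?R k" for x using positive_op_sym[OF R] by simp
    then have "y = ?R k" using vector_eq_ldot by blast
    then show "y \<in> range ?R" by blast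
  }
qed

section \<open>The Riesz map \<open>k\<close> and the operator \<open>D\<close>\<close>

locale positive_pair =
  fixes A B :: "'a::complex_hilbert \<Rightarrow> 'a"
  assumes A: "positive_op A" and B: "positive_op B"
begin

definition T :: "'a \<Rightarrow> 'a \<times> 'a"
  where "T z = (sqrt_op A z, sqrt_op B z)"

text \<open>The first two clauses determine the vector, by \<open>k_eqI\<close>; the norm clause
  supplies boundedness of \<open>k\<close>.\<close>

definition k :: "'a \<Rightarrow> 'a \<times> 'a"
  where "k x = (SOME \<kappa>. \<kappa> \<in> closure (range T) \<and> (\<forall>z. A x \<bullet> z = T z \<bullet> \<kappa>) \<and> norm \<kappa> \<le> norm (sqrt_op A x))"

text \<open>Formally, \<open>D = A (A + B)\<^sup>-\<^sup>1 A = A - (A:B)\<close>.\<close>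

definition D :: "'a \<Rightarrow> 'a"
  where "D x = sqrt_op A (fst (k x))"

sublocale A: bounded_linear A by (rule positive_op_bounded_linear[OF A])
sublocale B: bounded_linear B by (rule positive_op_bounded_linear[OF B])
sublocale sqrtA: bounded_linear "sqrt_op A"
  by (rule positive_op_bounded_linear[OF positive_sqrt_op[OF A]])
sublocale sqrtB: bounded_linear "sqrt_op B"
  by (rule positive_op_bounded_linear[OF positive_sqrt_op[OF B]])
sublocale T: bounded_linear T
  unfolding T_def
  by (intro bounded_linear_Pair sqrtA.bounded_linear_axioms sqrtB.bounded_linear_axioms)

lemma norm_T: "(norm (T z))\<^sup>2 = A z \<bullet> z + B z \<bullet> z"
  by (simp add: T_def power2_norm_eq_inner inner_Pair sqrt_op_inner A B)

lemma k_closure: "k x \<in> closure (range T)"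
  and k_inner_T: "T z \<bullet> k x = A x \<bullet> z"
  and norm_k_le: "norm (k x) \<le> norm (sqrt_op A x)"
proof -
  have ex: "\<exists>\<kappa>. \<kappa> \<in> closure (range T) \<and> (\<forall>z. A x \<bullet> z = T z \<bullet> \<kappa>) \<and> norm \<kappa> \<le> norm (sqrt_op A x)"
  proof -
    have "\<bar>A x \<bullet> z\<bar> \<le> norm (sqrt_op A x) * norm (T z)" for z
    proof -
      have "\<bar>A x \<bullet> z\<bar> \<le> norm (sqrt_op A x) * norm (sqrt_op A z)"
        using Cauchy_Schwarz_ineq2[of "sqrt_op A x" "sqrt_op A z"] by (simp add: sqrt_op_inner A)
      also have "norm (sqrt_op A z) \<le> norm (T z)"
        using norm_fst_le[of "sqrt_op A z" "sqrt_op B z"] by (simp add: T_def)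
      finally show ?thesis by (simp add: mult_left_mono)
    qed
    then show ?thesis
      using riesz_closure_range[of T "\<lambda>z. A x \<bullet> z" "norm (sqrt_op A x)"] T.linear
        bounded_linear.linear[OF bounded_linear_inner_right] by (metis norm_ge_zero)
  qed
  have *: "k x \<in> closure (range T) \<and> (\<forall>z. A x \<bullet> z = T z \<bullet> k x) \<and> norm (k x) \<le> norm (sqrt_op A x)"
    unfolding k_def by (rule someI_ex[OF ex])
  show "k x \<in> closure (range T)" "norm (k x) \<le> norm (sqrt_op A x)"
    using * by blast+
  show "T z \<bullet> k x = A x \<bullet> z" for z
    using * by metis
qed

lemma closure_range_TE:
  assumes "\<kappa> \<in> closure (range T)"
  obtains xs where "(\<lambda>n. T (xs n)) \<longlonglongrightarrow> \<kappa>"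
proof -
  obtain f where f: "\<And>n. f n \<in> range T" "f \<longlonglongrightarrow> \<kappa>"
    using assms unfolding closure_sequential by blast
  have "(\<lambda>n. T (inv T (f n))) = f"
    using f(1) by (simp add: f_inv_into_f)
  with f(2) that show thesis by metis
qed

lemma closure_range_TI:
  assumes "(\<lambda>n. T (xs n)) \<longlonglongrightarrow> \<kappa>"
  shows "\<kappa> \<in> closure (range T)"
  unfolding closure_sequential using assms by (intro exI[of _ "\<lambda>n. T (xs n)"]) simp

lemma tendsto_A:
  assumes "(\<lambda>n. T (xs n)) \<longlonglongrightarrow> \<kappa>"
  shows "(\<lambda>n. A (xs n)) \<longlonglongrightarrow> sqrt_op A (fst \<kappa>)"
  using sqrtA.tendsto[OF tendsto_fst[OF assms]] by (simp add: T_def positive_op_sqrt_apply A)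

text \<open>The adjoint of \<open>k\<close>: at \<open>\<kappa> = T z\<close> the right side is
  \<open>x \<bullet> A z\<close>, and both sides are continuous in \<open>\<kappa>\<close>.\<close>

lemma k_inner:
  assumes "\<kappa> \<in> closure (range T)"
  shows "k x \<bullet> \<kappa> = x \<bullet> sqrt_op A (fst \<kappa>)"
proof -
  obtain xs where xs: "(\<lambda>n. T (xs n)) \<longlonglongrightarrow> \<kappa>"
    using assms by (rule closure_range_TE)
  have "k x \<bullet> T (xs n) = x \<bullet> A (xs n)" for n
    using k_inner_T[of "xs n" x] positive_op_sym[OF A, of x "xs n"] by (simp add: inner_commute)
  moreover have "(\<lambda>n. k x \<bullet> T (xs n)) \<longlonglongrightarrow> k x \<bullet> \<kappa>"
    by (intro tendsto_intros xs)
  moreover have "(\<lambda>n. x \<bullet> A (xs n)) \<longlonglongrightarrow> x \<bullet> sqrt_op A (fst \<kappa>)"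
    by (intro tendsto_intros tendsto_A xs)
  ultimately show ?thesis using LIMSEQ_unique by simp
qed

lemma D_inner: "D x \<bullet> z = k x \<bullet> k z"
  using k_inner[OF k_closure, of z x] by (simp add: D_def inner_commute)

text \<open>The difference \<open>k x - \<kappa>\<close> is orthogonal to the range of
  \<open>T\<close> and is itself a limit of vectors from that range, hence orthogonal to itself.
  Linearity of \<open>k\<close>, defined by choice, is derived from this.\<close>

lemma k_eqI:
  assumes "\<kappa> \<in> closure (range T)" "\<And>z. T z \<bullet> \<kappa> = A x \<bullet> z"
  shows "k x = \<kappa>"
proof -
  obtain xs where xs: "(\<lambda>n. T (xs n)) \<longlonglongrightarrow> \<kappa>"
    using assms(1) by (rule closure_range_TE)
  obtain ys where ys: "(\<lambda>n. T (ys n)) \<longlonglongrightarrow> k x"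
    using k_closure by (rule closure_range_TE)
  have "(\<lambda>n. (T (ys n) - T (xs n)) \<bullet> (k x - \<kappa>)) \<longlonglongrightarrow> (k x - \<kappa>) \<bullet> (k x - \<kappa>)"
    by (intro tendsto_intros xs ys)
  moreover have "(T (ys n) - T (xs n)) \<bullet> (k x - \<kappa>) = 0" for n
    by (simp add: inner_diff_left inner_diff_right assms(2) k_inner_T)
  ultimately have "(k x - \<kappa>) \<bullet> (k x - \<kappa>) = 0"
    using LIMSEQ_unique tendsto_const by fastforce
  then show ?thesis by simp
qed

lemma T_scaleC: "T (c *\<^sub>C z) = (c *\<^sub>C sqrt_op A z, c *\<^sub>C sqrt_op B z)"
  by (simp add: T_def positive_op_scaleC positive_sqrt_op A B)

text \<open>The scalar acts componentwise because the pair space is used only as a real inner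
  product space.\<close>

lemma k_scaleC: "k (c *\<^sub>C x) = (c *\<^sub>C fst (k x), c *\<^sub>C snd (k x))"
proof (rule k_eqI)
  obtain xs where xs: "(\<lambda>n. T (xs n)) \<longlonglongrightarrow> k x"
    using k_closure by (rule closure_range_TE)
  have "(\<lambda>n. T (c *\<^sub>C xs n)) \<longlonglongrightarrow> (c *\<^sub>C fst (k x), c *\<^sub>C snd (k x))"
    using tendsto_fst[OF xs] tendsto_snd[OF xs] unfolding T_scaleC
    by (intro tendsto_Pair bounded_linear.tendsto[OF bounded_linear_scaleC]) (simp_all add: T_def)
  then show "(c *\<^sub>C fst (k x), c *\<^sub>C snd (k x)) \<in> closure (range T)"
    by (rule closure_range_TI)
next
  fix z
  have "T z \<bullet> (c *\<^sub>C fst (k x), c *\<^sub>C snd (k x)) = T (cnj c *\<^sub>C z) \<bullet> k x"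
    unfolding T_scaleC by (cases "k x") (simp add: T_def inner_scaleC_left)
  also have "\<dots> = A (c *\<^sub>C x) \<bullet> z"
    by (simp add: k_inner_T positive_op_scaleC A inner_scaleC_left)
  finally show "T z \<bullet> (c *\<^sub>C fst (k x), c *\<^sub>C snd (k x)) = A (c *\<^sub>C x) \<bullet> z" .
qed

lemma k_add: "k (x + y) = k x + k y"
proof (rule k_eqI)
  obtain xs where xs: "(\<lambda>n. T (xs n)) \<longlonglongrightarrow> k x"
    using k_closure by (rule closure_range_TE)
  obtain ys where ys: "(\<lambda>n. T (ys n)) \<longlonglongrightarrow> k y"
    using k_closure by (rule closure_range_TE)
  have "(\<lambda>n. T (xs n + ys n)) \<longlonglongrightarrow> k x + k y"
    unfolding T.add by (intro tendsto_add xs ys)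
  then show "k x + k y \<in> closure (range T)"
    by (rule closure_range_TI)
qed (simp add: inner_add_left inner_add_right k_inner_T A.add)

lemma bounded_linear_k: "bounded_linear k"
proof -
  obtain K where K: "\<And>x. norm (sqrt_op A x) \<le> norm x * K" using sqrtA.bounded by blast
  show ?thesis
  proof (rule bounded_linear_intro[where K = K])
    show "k (r *\<^sub>R x) = r *\<^sub>R k x" for r x
      using k_scaleC[of "complex_of_real r" x] by (simp add: scaleC_of_real prod_eq_iff)
    show "norm (k x) \<le> norm x * K" for x
      using norm_k_le K by (rule order_trans)
  qed (rule k_add)
qed

lemma positive_op_D: "positive_op D"
  unfolding positive_op_iff_psd psd_def
proof (intro conjI allI)
  show "bounded_linear D"
    unfolding D_def
    by (rule bounded_linear_compose[OF sqrtA.bounded_linear_axioms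
          bounded_linear_compose[OF bounded_linear_fst bounded_linear_k]])
  show "D x \<bullet> y = x \<bullet> D y" for x y
    by (simp add: D_inner inner_commute[of x])  (simp add: inner_commute)
  show "0 \<le> D x \<bullet> x" for x
    by (simp add: D_inner)
  show "D (c *\<^sub>C x) = c *\<^sub>C D x" for c x
    by (simp add: D_def k_scaleC positive_op_scaleC positive_sqrt_op A)
qed

section \<open>The infimum and the supremum as quadratic forms\<close>

lemma Inf_quadratic_form:
  "(INF y. Re (cinner (A (x - y)) (x - y) + cinner (B y) y)) = (A x - D x) \<bullet> x"
proof -
  have eq: "Re (cinner (A (x - y)) (x - y) + cinner (B y) y) = (A x - D x) \<bullet> x + (norm (T y - k x))\<^sup>2" for y
  proof -
    have "(norm (T y - k x))\<^sup>2 = A y \<bullet> y + B y \<bullet> y - 2 * (A x \<bullet> y) + D x \<bullet> x"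
      using norm_T[of y]
      by (simp add: power2_norm_eq_inner inner_diff_left inner_diff_right D_inner k_inner_T
          inner_commute[of "k x" "T y"])
    moreover have "A y \<bullet> x = A x \<bullet> y"
      using positive_op_sym[OF A] by (metis inner_commute)
    ultimately show ?thesis
      by (simp add: Re_cinner A.diff inner_diff_left inner_diff_right)
  qed
  show ?thesis
    unfolding eq
  proof (rule cInf_eq_non_empty)
    fix b assume b: "\<And>v. v \<in> range (\<lambda>y. (A x - D x) \<bullet> x + (norm (T y - k x))\<^sup>2) \<Longrightarrow> b \<le> v"
    \<comment> \<open>The infimum need not be attained, but \<open>k x\<close> is a limit of vectors
      \<open>T (xs n)\<close>, so the square becomes arbitrarily small.\<close>
    obtain xs where xs: "(\<lambda>n. T (xs n)) \<longlonglongrightarrow> k x"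
      using k_closure by (rule closure_range_TE)
    have "(\<lambda>n. (A x - D x) \<bullet> x + (norm (T (xs n) - k x))\<^sup>2)
        \<longlonglongrightarrow> (A x - D x) \<bullet> x + (norm (k x - k x))\<^sup>2"
      by (intro tendsto_intros xs)
    then show "b \<le> (A x - D x) \<bullet> x"
      using b by (intro LIMSEQ_le_const) auto
  qed auto
qed

lemma parallel_sum_eq: "parallel_sum A B = (\<lambda>x. A x - D x)"
proof -
  have D: "psd D" "\<And>c x. D (c *\<^sub>C x) = c *\<^sub>C D x"
    using positive_op_D by (auto simp: positive_op_iff_psd)
  \<comment> \<open>The form of \<open>A - D\<close> is an infimum of nonnegative numbers.\<close>
  have nonneg: "0 \<le> (A x - D x) \<bullet> x" for x
    unfolding Inf_quadratic_form[symmetric]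
    by (rule cINF_greatest) (auto simp: Re_cinner positive_op_nonneg A B)
  have "psd (\<lambda>x. A x - D x)"
    unfolding psd_def
    by (intro conjI allI nonneg bounded_linear_sub A.bounded_linear_axioms psd_bounded_linear[OF D(1)])
      (simp add: inner_diff_left inner_diff_right positive_op_sym[OF A] psd_sym[OF D(1)])
  moreover have "A (c *\<^sub>C x) - D (c *\<^sub>C x) = c *\<^sub>C (A x - D x)" for c x
    by (simp add: positive_op_scaleC[OF A] D(2) linear_diff[OF bounded_linear.linear[OF bounded_linear_scaleC]])
  ultimately have P: "positive_op (\<lambda>x. A x - D x)"
    by (simp add: positive_op_iff_psd)
  show ?thesis
    unfolding parallel_sum_def Inf_quadratic_form
  proof (rule the_equality)
    show "positive_op (\<lambda>x. A x - D x) \<and>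
      (\<forall>x. cinner (A x - D x) x = complex_of_real ((A x - D x) \<bullet> x))"
      using P positive_op_cinner[OF P] by blast
  next
    fix C assume C: "positive_op C \<and> (\<forall>x. cinner (C x) x = complex_of_real ((A x - D x) \<bullet> x))"
    then have "C x \<bullet> x = (A x - D x) \<bullet> x" for x
      by (metis Re_cinner Re_complex_of_real)
    then show "C = (\<lambda>x. A x - D x)"
      using C P by (intro psd_eq_if_quadratic_form_eq) (auto simp: positive_op_iff_psd)
  qed
qed

lemma Sup_eq:
  "Sup {(cmod (cinner (A x) z))\<^sup>2 | z. Re (cinner (A z) z + cinner (B z) z) \<le> 1} = D x \<bullet> x"
  (is "Sup ?M = _")
proof (rule cSup_eq_non_empty)
  \<comment> \<open>The constraint describes the preimage under \<open>T\<close> of the closed unit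
    ball.\<close>
  have feasible: "Re (cinner (A z) z + cinner (B z) z) \<le> 1 \<longleftrightarrow> norm (T z) \<le> 1" for z
    using abs_square_le_1[of "norm (T z)"] by (simp add: Re_cinner norm_T)
  have "(cmod (cinner (A x) 0))\<^sup>2 \<in> ?M"
    by (intro CollectI exI[of _ 0]) (simp add: Re_cinner feasible A.zero B.zero)
  then show "?M \<noteq> {}" by blast
  {
    fix v assume "v \<in> ?M"
    then obtain z where z: "v = (cmod (cinner (A x) z))\<^sup>2" "norm (T z) \<le> 1"
      using feasible by blast
    obtain c where c: "cmod c = 1" "cmod (cinner (A x) z) = (c *\<^sub>C A x) \<bullet> z"
      by (rule cmod_cinner_rotate)
    have "cmod (cinner (A x) z) = T z \<bullet> k (c *\<^sub>C x)"
      by (simp add: c(2) k_inner_T positive_op_scaleC A)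
    also have "\<dots> \<le> norm (T z) * norm (k (c *\<^sub>C x))" by (rule norm_cauchy_schwarz)
    also have "norm (k (c *\<^sub>C x)) = norm (k x)"
      unfolding k_scaleC by (cases "k x") (simp add: norm_Pair norm_scaleC c(1))
    also have "norm (T z) * norm (k x) \<le> norm (k x)"
      using z(2) by (simp add: mult_left_le_one_le)
    finally have "(cmod (cinner (A x) z))\<^sup>2 \<le> (norm (k x))\<^sup>2" by (intro power_mono) auto
    then show "v \<le> D x \<bullet> x" by (simp add: z(1) D_inner power2_norm_eq_inner)
  next
    fix b assume b: "\<And>v. v \<in> ?M \<Longrightarrow> v \<le> b"
    \<comment> \<open>Homogenised form of the upper bound \<open>b\<close>: normalise
      \<open>z\<close> when \<open>T z \<noteq> 0\<close>. Letting \<open>T z\<close> tend to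
      \<open>k x\<close> then gives
      \<open>(D x \<bullet> x)\<^sup>2 \<le> b * (D x \<bullet> x)\<close>.\<close>
    have le: "(T z \<bullet> k x)\<^sup>2 \<le> b * (norm (T z))\<^sup>2" for z
    proof (cases "T z = 0")
      case False
      define w where "w = (1 / norm (T z)) *\<^sub>R z"
      have "norm (T w) \<le> 1" using False by (simp add: w_def T.scaleR)
      then have "(cmod (cinner (A x) w))\<^sup>2 \<le> b" using b feasible by blast
      moreover have "(A x \<bullet> w)\<^sup>2 \<le> (cmod (cinner (A x) w))\<^sup>2"
        by (rule inner_square_le_cmod_cinner)
      moreover have "(A x \<bullet> w)\<^sup>2 = (T z \<bullet> k x)\<^sup>2 / (norm (T z))\<^sup>2"
        by (simp add: w_def k_inner_T power_divide)
      ultimately have "(T z \<bullet> k x)\<^sup>2 / (norm (T z))\<^sup>2 \<le> b" by linarith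
      then show ?thesis using False by (simp add: pos_divide_le_eq)
    qed simp
    obtain xs where xs: "(\<lambda>n. T (xs n)) \<longlonglongrightarrow> k x"
      using k_closure by (rule closure_range_TE)
    have "(k x \<bullet> k x)\<^sup>2 \<le> b * (norm (k x))\<^sup>2"
      by (rule LIMSEQ_le[of "\<lambda>n. (T (xs n) \<bullet> k x)\<^sup>2" _ "\<lambda>n. b * (norm (T (xs n)))\<^sup>2"])
        (use le in \<open>auto intro!: tendsto_intros xs\<close>)
    then have "(D x \<bullet> x) * (D x \<bullet> x) \<le> b * (D x \<bullet> x)"
      by (simp add: D_inner power2_norm_eq_inner power2_eq_square[of "k x \<bullet> k x"])
    moreover have "0 \<le> D x \<bullet> x" by (simp add: D_inner)
    \<comment> \<open>Dividing by \<open>D x \<bullet> x\<close> fails when it is 0; there the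
      feasible point \<open>z = 0\<close> settles the claim.\<close>
    moreover have "0 \<le> b"
      using b[OF \<open>(cmod (cinner (A x) 0))\<^sup>2 \<in> ?M\<close>] by (meson order_trans zero_le_power2)
    ultimately show "D x \<bullet> x \<le> b"
      by (cases "D x \<bullet> x = 0") auto
  }
qed

section \<open>The range of the square root of \<open>D\<close> and the three assertions\<close>

text \<open>Since \<open>sqrt_op D x\<close> and \<open>k x\<close> have equal norms, a bound on
  \<open>x \<bullet> y\<close> by one is a bound by the other; the Riesz lemma is applied through
  \<open>k\<close> in one direction and through \<open>sqrt_op D\<close> in the other.\<close>

lemma range_sqrt_op_D_iff_closure:
  "y \<in> range (sqrt_op D) \<longleftrightarrow> (\<exists>\<kappa> \<in> closure (range T). y = sqrt_op A (fst \<kappa>))"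
proof
  let ?R = "sqrt_op D"
  have R: "positive_op ?R" by (rule positive_sqrt_op[OF positive_op_D])
  have norm_R: "norm (?R x) = norm (k x)" for x
    by (simp add: norm_eq_sqrt_inner sqrt_op_inner[OF positive_op_D] D_inner)
  {
    assume "y \<in> range ?R"
    then obtain w where w: "y = ?R w" by blast
    have "\<bar>x \<bullet> y\<bar> \<le> norm w * norm (k x)" for x
      using Cauchy_Schwarz_ineq2[of "?R x" w]
      by (simp add: w positive_op_sym[OF R] norm_R mult.commute)
    then obtain \<kappa> where \<kappa>: "\<kappa> \<in> closure (range k)" "\<And>x. x \<bullet> y = k x \<bullet> \<kappa>"
      using riesz_closure_range[OF bounded_linear.linear[OF bounded_linear_k] bounded_linear.linear[OF bounded_linear_inner_left] norm_ge_zero]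
      by metis
    have "closure (range k) \<subseteq> closure (range T)"
      using k_closure by (intro closure_minimal) auto
    with \<kappa>(1) have "\<kappa> \<in> closure (range T)" by blast
    moreover from this have "y = sqrt_op A (fst \<kappa>)"
      using \<kappa>(2) k_inner vector_eq_ldot by metis
    ultimately show "\<exists>\<kappa> \<in> closure (range T). y = sqrt_op A (fst \<kappa>)" by blast
  next
    assume "\<exists>\<kappa> \<in> closure (range T). y = sqrt_op A (fst \<kappa>)"
    then obtain \<kappa> where \<kappa>: "\<kappa> \<in> closure (range T)" "y = sqrt_op A (fst \<kappa>)" by blast
    have "\<bar>x \<bullet> y\<bar> \<le> norm \<kappa> * norm (?R x)" for x
      using Cauchy_Schwarz_ineq2[of "k x" \<kappa>] by (simp add: \<kappa>(2) k_inner[OF \<kappa>(1)] norm_R mult.commute)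
    then obtain w where "\<And>x. x \<bullet> y = ?R x \<bullet> w"
      using riesz_closure_range[OF bounded_linear.linear[OF positive_op_bounded_linear[OF R]]
          bounded_linear.linear[OF bounded_linear_inner_left] norm_ge_zero]
      by metis
    then have "y = ?R w" using positive_op_sym[OF R] vector_eq_ldot by metis
    then show "y \<in> range ?R" by blast
  }
qed

end

theorem theorem2p7:
  fixes A B :: "'a::complex_hilbert \<Rightarrow> 'a" and y :: 'a
  assumes "positive_op A" and "positive_op B"
  defines "assertion_i \<equiv> y \<in> range (sqrt_op (\<lambda>x. A x - parallel_sum A B x))"
    and "assertion_ii \<equiv> \<exists>x :: nat \<Rightarrow> 'a. (\<lambda>n. A (x n)) \<longlonglongrightarrow> y \<and>
      convergent (\<lambda>n. sqrt_op A (x n)) \<and> convergent (\<lambda>n. sqrt_op B (x n))"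
    and "assertion_iii \<equiv> \<exists>m::real. m \<ge> 0 \<and> (\<forall>x. (cmod (cinner x y))\<^sup>2 \<le>
      m * Sup {(cmod (cinner (A x) z))\<^sup>2 | z. Re (cinner (A z) z + cinner (B z) z) \<le> 1})"
  shows "(assertion_i \<longleftrightarrow> assertion_ii) \<and> (assertion_ii \<longleftrightarrow> assertion_iii)"
proof -
  interpret positive_pair A B using assms(1,2) by unfold_locales
  have i: "assertion_i \<longleftrightarrow> y \<in> range (sqrt_op D)"
    by (simp add: assertion_i_def parallel_sum_eq)
  \<comment> \<open>Convergence of both root sequences is convergence of \<open>T (xs n)\<close> in
    the product, and \<open>tendsto_A\<close> identifies the limit of
    \<open>A (xs n)\<close>.\<close>
  have ii: "assertion_ii \<longleftrightarrow> (\<exists>\<kappa> \<in> closure (range T). y = sqrt_op A (fst \<kappa>))"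
  proof
    assume assertion_ii
    then obtain xs u v where xs: "(\<lambda>n. A (xs n)) \<longlonglongrightarrow> y"
      "(\<lambda>n. sqrt_op A (xs n)) \<longlonglongrightarrow> u" "(\<lambda>n. sqrt_op B (xs n)) \<longlonglongrightarrow> v"
      unfolding assertion_ii_def convergent_def by blast
    then have lim: "(\<lambda>n. T (xs n)) \<longlonglongrightarrow> (u, v)"
      unfolding T_def by (intro tendsto_Pair)
    then have "y = sqrt_op A (fst (u, v))"
      using LIMSEQ_unique[OF xs(1)] tendsto_A by blast
    then show "\<exists>\<kappa> \<in> closure (range T). y = sqrt_op A (fst \<kappa>)"
      using closure_range_TI[OF lim] by blast
  next
    assume "\<exists>\<kappa> \<in> closure (range T). y = sqrt_op A (fst \<kappa>)"
    then obtain \<kappa> xs where \<kappa>: "y = sqrt_op A (fst \<kappa>)" and xs: "(\<lambda>n. T (xs n)) \<longlonglongrightarrow> \<kappa>"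
      by (elim bexE closure_range_TE) blast
    then show assertion_ii
      unfolding assertion_ii_def convergent_def
      using tendsto_A[OF xs] tendsto_fst[OF xs] tendsto_snd[OF xs] by (auto simp: T_def)
  qed
  have iii: "assertion_iii \<longleftrightarrow> y \<in> range (sqrt_op D)"
    unfolding assertion_iii_def Sup_eq range_sqrt_op_iff[OF positive_op_D] by blast
  show ?thesis
    using i ii iii range_sqrt_op_D_iff_closure by blast
qed

end
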